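(* Let $f$, $c$, $F$ be as in the context, let $\beta\in[0,1)$ and $\theta_0\in\mathbb{R}^n$, and let $(\theta_k,r_k,v_k)$ be generated by the AGEM scheme with step size $\eta>0$: $$v_k=\beta v_{k-1}+(1-\beta)\nabla F(\theta_k),\quad v_{-1}=0,\qquad r_{k+1}=\frac{r_k}{1+2\eta|v_k|^2},\quad r_0=F(\theta_0),\qquad \theta_{k+1}=\theta_k-2\eta r_{k+1}v_k,\qquad k\ge 0.$$ Then there exists $\eta^*>0$ such that if $\eta<\eta^*$ the following hold. (1) (Uniform boundedness) $\theta_k$ and $v_k$ are bounded for all $k\ge 1$; moreover $$\theta_k\in\{\theta\in\mathbb{R}^n : F(\theta)\le 2F(\theta_0)\},\qquad |v_k|\le \max_{j\le k}|\nabla F(\theta_j)| .$$ (2) (Lower bound on energy) With $r^*:=\lim_{k\to\infty}r_k$, $$r_k\ge r_{k+1}>r^*>0\qquad\forall k\ge 0 .$$ (3) (Convergence) As $k\to\infty$, $$r_k\to r^*>0,\qquad v_k\to 0,\qquad \nabla f(\theta_k)\to 0 .$$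
   Context: Standing assumptions: $f:\mathbb{R}^n\to\mathbb{R}$ is $C^2$, coercive ($\lim_{|\theta|\to\infty}f(\theta)=\infty$) and bounded from below; $c\in\mathbb{R}$ is chosen so that, with $f^*=\min f$, $F(\theta):=\sqrt{f(\theta)+c}\ge F^*:=\sqrt{f^*+c}>0$ for all $\theta\in\mathbb{R}^n$. $|\cdot|$ is the Euclidean norm.
   Formalization: The strict inequality r_{k+1} > r* in (2) is proved only when ∇f(θ_0) ≠ 0; if ∇f(θ_0) = 0 then r_k is constant and strictness fails (e.g. f = |θ|², c = 1, θ_0 = 0), so only r_{k+1} ≥ r* > 0 is claimed there. *)

theory Defs
  imports "HOL-Analysis.Analysis"
begin

definition C2 :: "('a::real_normed_vector \<Rightarrow> real) \<Rightarrow> bool" where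
  "C2 f \<longleftrightarrow> (\<exists>(D :: 'a \<Rightarrow> 'a \<Rightarrow>\<^sub>L real) (D2 :: 'a \<Rightarrow> 'a \<Rightarrow>\<^sub>L ('a \<Rightarrow>\<^sub>L real)).
     (\<forall>x. (f has_derivative blinfun_apply (D x)) (at x)) \<and>
     (\<forall>x. (D has_derivative blinfun_apply (D2 x)) (at x)) \<and>
     continuous_on UNIV D2)"

definition coercive :: "('a::real_normed_vector \<Rightarrow> real) \<Rightarrow> bool" where
  "coercive f \<longleftrightarrow> filterlim f at_top at_infinity"

(* Unspecified where f is not differentiable; unique where it is. *)
definition gradient :: "('a::real_inner \<Rightarrow> real) \<Rightarrow> 'a \<Rightarrow> 'a" where
  "gradient f x = (THE g. GDERIV f x :> g)"

(* LEAST over the range is the attained minimum (not merely the infimum); it is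
   well defined for continuous coercive f. *)
definition min_value :: "('a \<Rightarrow> real) \<Rightarrow> real" where
  "min_value f = (LEAST y. y \<in> range f)"

(* The library's sqrt is odd, so sqrt (f x + c) > 0 forces f x + c > 0. *)
definition shifted_sqrt :: "('a \<Rightarrow> real) \<Rightarrow> real \<Rightarrow> 'a \<Rightarrow> real" where
  "shifted_sqrt f c = (\<lambda>x. sqrt (f x + c))"

(* The "if" supplies the convention v_{-1} = 0. *)
definition AGEM ::
  "('a::real_inner \<Rightarrow> real) \<Rightarrow> real \<Rightarrow> real \<Rightarrow> 'a \<Rightarrow> (nat \<Rightarrow> 'a) \<Rightarrow> (nat \<Rightarrow> real) \<Rightarrow> (nat \<Rightarrow> 'a) \<Rightarrow> bool"
  where
  "AGEM F \<beta> \<eta> \<theta>0 \<theta> r v \<longleftrightarrow>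
     \<theta> 0 = \<theta>0 \<and> r 0 = F \<theta>0 \<and>
     (\<forall>k. v k = \<beta> *\<^sub>R (if k = 0 then 0 else v (k - 1)) + (1 - \<beta>) *\<^sub>R gradient F (\<theta> k)) \<and>
     (\<forall>k. r (Suc k) = r k / (1 + 2 * \<eta> * (norm (v k))\<^sup>2)) \<and>
     (\<forall>k. \<theta> (Suc k) = \<theta> k - (2 * \<eta> * r (Suc k)) *\<^sub>R v k)"

end

theory Submission
  imports Defs
begin

text \<open>
  Write \<open>m\<close> for the positive lower bound \<open>sqrt (min_value f + c)\<close> of \<open>F\<close>. Everything rests on a
  Lyapunov function for the scheme, the function value plus a multiple of the squared momentum,
  \<open>E k = F (\<theta> k) + \<eta> * \<beta> / (1 - \<beta>) * r k * |v (k - 1)|^2\<close>.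
  The recursion for \<open>v\<close> gives \<open>(1 - \<beta>) * (v k \<bullet> gradient F (\<theta> k)) = |v k|^2 - \<beta> * (v k \<bullet> v (k - 1))\<close>,
  so along a step the first-order decrease of \<open>F\<close> is \<open>2 * \<eta> * r (Suc k) * |v k|^2\<close> up to a
  momentum contribution that telescopes in \<open>E\<close>. That decrease is exactly the drop
  \<open>r k - r (Suc k)\<close>. The second-order error, controlled by a Lipschitz constant \<open>L\<close> of the
  gradient, is at most a fraction \<open>q = 2 * \<eta> * L * F \<theta>0\<close> of it. Hence (\<open>energy_step\<close>)
  \<open>E (Suc k) \<le> E k - (1 - q) * (r k - r (Suc k))\<close>,
  that is, \<open>E k - (1 - q) * r k\<close> never exceeds its initial value \<open>q * F \<theta>0\<close>.

  This one inequality (\<open>invariants\<close>) yields both bounds. Since \<open>r k \<le> F \<theta>0\<close>, it gives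
  \<open>F (\<theta> k) \<le> F \<theta>0\<close>; coercivity then keeps the iterates in a fixed ball, on which the \<open>C2\<close> function
  \<open>F\<close> has a bounded, Lipschitz gradient, so that \<open>L\<close> and the bound on \<open>\<eta>\<close> are the same for the
  whole run. And since \<open>E k \<ge> m\<close>, once \<open>q * F \<theta>0 \<le> m / 2\<close> it gives \<open>r k \<ge> m / 2\<close> (\<open>r_ge\<close>).

  Convergence follows: \<open>r\<close> decreases to a positive limit, its drops control \<open>|v k|^2\<close> and tend to \<open>0\<close>,
  and the gradients are combinations of consecutive \<open>v k\<close>. If the starting point is not critical,
  the limit of \<open>r\<close> is never attained because a nonzero \<open>v k\<close> is followed by another one within two
  steps (\<open>v_nonzero_recurs\<close>): with steps this short, the scheme cannot move exactly onto a critical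
  point and stay there.
\<close>

section \<open>Gradients\<close>

lemma gradient_eqI:
  assumes "GDERIV f x :> g"
  shows "gradient f x = g"
  unfolding gradient_def
proof (rule the_equality[where P = "\<lambda>g. GDERIV f x :> g", OF assms])
  fix g' assume "GDERIV f x :> g'"
  with assms have eq: "(\<lambda>h. h \<bullet> g) = (\<lambda>h. h \<bullet> g')"
    unfolding gderiv_def by (rule has_derivative_unique)
  have "(g' - g) \<bullet> g = (g' - g) \<bullet> g'" using fun_cong[OF eq] .
  then have "(g' - g) \<bullet> (g' - g) = 0" by (simp add: inner_diff_right)
  then show "g' = g" by simp
qed

lemma blinfun_inner_representation:
  fixes T :: "'a::euclidean_space \<Rightarrow>\<^sub>L real"
  shows "blinfun_apply T = (\<lambda>h. h \<bullet> (\<Sum>b\<in>Basis. T b *\<^sub>R b))"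
proof
  fix h
  have "T h = T (\<Sum>b\<in>Basis. (h \<bullet> b) *\<^sub>R b)" by (simp add: euclidean_representation)
  also have "\<dots> = (\<Sum>b\<in>Basis. (h \<bullet> b) * T b)"
    by (simp add: blinfun.sum_right blinfun.scaleR_right)
  also have "\<dots> = h \<bullet> (\<Sum>b\<in>Basis. T b *\<^sub>R b)"
    by (simp add: inner_sum_right mult.commute)
  finally show "T h = h \<bullet> (\<Sum>b\<in>Basis. T b *\<^sub>R b)" .
qed

lemma has_derivative_imp_GDERIV_gradient:
  fixes T :: "'a::euclidean_space \<Rightarrow>\<^sub>L real"
  assumes "(f has_derivative blinfun_apply T) (at x)"
  shows "GDERIV f x :> gradient f x" and "blinfun_apply T = (\<lambda>h. h \<bullet> gradient f x)"
proof -
  have 1: "GDERIV f x :> (\<Sum>b\<in>Basis. T b *\<^sub>R b)"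
    unfolding gderiv_def blinfun_inner_representation[of T, symmetric] by (rule assms)
  note 2 = gradient_eqI[OF 1]
  show "GDERIV f x :> gradient f x" using 1 unfolding 2 .
  show "blinfun_apply T = (\<lambda>h. h \<bullet> gradient f x)"
    unfolding 2 by (rule blinfun_inner_representation)
qed

lemma norm_le_if_inner_le:
  fixes u :: "'a::real_inner"
  assumes "u \<bullet> u \<le> C * norm u" "0 \<le> C"
  shows "norm u \<le> C"
proof (cases "u = 0")
  case False
  then have "norm u * norm u \<le> C * norm u"
    using assms(1) by (simp add: dot_square_norm power2_eq_square)
  with False show ?thesis by simp
qed (use assms in simp)

lemma C2_imp_GDERIV_gradient:
  fixes f :: "'a::euclidean_space \<Rightarrow> real"
  assumes "C2 f"
  shows "GDERIV f x :> gradient f x"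
  using assms has_derivative_imp_GDERIV_gradient(1) unfolding C2_def by blast

text \<open>The second derivative is bounded on the compact set, so the derivative is Lipschitz there as
  a map into the dual space; testing a difference of derivatives against the corresponding
  difference of gradients transfers the constant.\<close>
lemma C2_imp_gradient_lipschitz_on:
  fixes f :: "'a::euclidean_space \<Rightarrow> real"
  assumes "C2 f" "compact K" "convex K"
  obtains L where "lipschitz_on L K (gradient f)"
proof -
  obtain D D2 where D: "\<And>x. (f has_derivative blinfun_apply (D x)) (at x)"
    and D2: "\<And>x. (D has_derivative blinfun_apply (D2 x)) (at x)"
    and cont: "continuous_on UNIV D2"
    using assms(1) unfolding C2_def by blast
  have "compact (D2 ` K)"
    by (rule compact_continuous_image[OF continuous_on_subset[OF cont] assms(2)]) simp
  then obtain L where L: "\<And>x. x \<in> K \<Longrightarrow> norm (D2 x) \<le> L" and "0 < L"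
    using bounded_pos[of "D2 ` K"] by (auto simp: compact_imp_bounded)
  have "norm (gradient f x - gradient f y) \<le> L * norm (x - y)" if "x \<in> K" "y \<in> K" for x y
  proof (rule norm_le_if_inner_le)
    let ?u = "gradient f x - gradient f y"
    have "norm (D x - D y) \<le> L * norm (x - y)"
      by (rule differentiable_bound[OF assms(3), where f' = "\<lambda>z. blinfun_apply (D2 z)"])
        (use D2 L that in \<open>auto simp: has_derivative_at_withinI norm_blinfun.rep_eq[symmetric]\<close>)
    moreover have "?u \<bullet> ?u = (D x - D y) ?u"
      using has_derivative_imp_GDERIV_gradient(2)[OF D]
      by (simp add: blinfun.diff_left inner_diff_right)
    moreover have "(D x - D y) ?u \<le> norm (D x - D y) * norm ?u"
      using norm_blinfun[of "D x - D y" ?u] by simp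
    moreover have "norm (D x - D y) * norm ?u \<le> L * norm (x - y) * norm ?u"
      by (rule mult_right_mono) (use calculation in simp_all)
    ultimately show "?u \<bullet> ?u \<le> L * norm (x - y) * norm ?u" by linarith
  qed (use \<open>0 < L\<close> in simp)
  then show ?thesis
    using \<open>0 < L\<close> by (intro that[of L] lipschitz_onI) (auto simp: dist_norm)
qed

text \<open>The mean value inequality applied to \<open>F\<close> minus its linearization at \<open>x\<close>. The sharper constant
  \<open>L / 2\<close> of the integral form of the remainder would only change the admissible step size by a
  constant factor.\<close>
lemma descent_estimate:
  assumes grad: "\<And>x. GDERIV F x :> gradient F x"
    and lip: "lipschitz_on L B (gradient F)"
    and seg: "closed_segment x y \<subseteq> B"
  shows "F y \<le> F x + (y - x) \<bullet> gradient F x + L * (norm (y - x))\<^sup>2"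
proof -
  have xB: "x \<in> B" using seg by auto
  have "norm (F y - F x - (y - x) \<bullet> gradient F x) \<le> norm (y - x) * (L * norm (y - x))"
  proof (rule differentiable_bound_linearization[where f' = "\<lambda>z h. h \<bullet> gradient F z"
        and S = "closed_segment x y"])
    fix t :: real assume "t \<in> {0..1}"
    then show "x + t *\<^sub>R (y - x) \<in> closed_segment x y"
      unfolding in_segment by (intro exI[of _ t]) (auto simp: algebra_simps)
  next
    fix z assume z: "z \<in> closed_segment x y"
    show "(F has_derivative (\<lambda>h. h \<bullet> gradient F z)) (at z within closed_segment x y)"
      using grad unfolding gderiv_def by (rule has_derivative_at_withinI)
    have "dist (gradient F z) (gradient F x) \<le> L * dist z x"
      using lip z seg xB by (intro lipschitz_onD) auto
    also have "\<dots> \<le> L * norm (y - x)"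
      using segment_bound(1)[OF z] lipschitz_on_nonneg[OF lip]
      by (intro mult_left_mono) (auto simp: dist_norm)
    finally have *: "norm (gradient F z - gradient F x) \<le> L * norm (y - x)"
      by (simp add: dist_norm)
    show "onorm ((\<lambda>h. h \<bullet> gradient F z) - (\<lambda>h. h \<bullet> gradient F x)) \<le> L * norm (y - x)"
      unfolding fun_diff_def
    proof (rule onorm_bound)
      show "0 \<le> L * norm (y - x)" using lipschitz_on_nonneg[OF lip] by simp
      fix h
      have "norm (h \<bullet> gradient F z - h \<bullet> gradient F x) \<le> norm h * norm (gradient F z - gradient F x)"
        using Cauchy_Schwarz_ineq2[of h "gradient F z - gradient F x"] by (simp add: inner_diff_right)
      also have "\<dots> \<le> norm h * (L * norm (y - x))" by (intro mult_left_mono *) simp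
      finally show "norm (h \<bullet> gradient F z - h \<bullet> gradient F x) \<le> L * norm (y - x) * norm h"
        by (simp add: mult.commute)
    qed
  qed auto
  then show ?thesis by (simp add: power2_eq_square algebra_simps abs_le_iff)
qed

section \<open>The shifted square root\<close>

lemma shifted_sqrt_gradient:
  assumes f: "GDERIV f x :> gradient f x" and pos: "0 < shifted_sqrt f c x"
  shows "GDERIV (shifted_sqrt f c) x :> gradient (shifted_sqrt f c) x"
    and "gradient f x = (2 * shifted_sqrt f c x) *\<^sub>R gradient (shifted_sqrt f c) x"
proof -
  let ?F = "shifted_sqrt f c"
  have fc: "0 < f x + c" using pos by (simp add: shifted_sqrt_def)
  have "((\<lambda>x. sqrt (f x + c)) has_derivative (\<lambda>h. h \<bullet> (inverse (2 * ?F x) *\<^sub>R gradient f x))) (at x)"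
    using fc f unfolding gderiv_def
    by (auto intro!: derivative_eq_intros simp: shifted_sqrt_def field_simps)
  then have 1: "GDERIV ?F x :> (inverse (2 * ?F x) *\<^sub>R gradient f x)"
    unfolding gderiv_def shifted_sqrt_def .
  note 2 = gradient_eqI[OF 1]
  show "GDERIV ?F x :> gradient ?F x" using 1 unfolding 2 .
  show "gradient f x = (2 * ?F x) *\<^sub>R gradient ?F x" unfolding 2 using pos by simp
qed

text \<open>From \<open>gradient f = 2 F gradient F\<close>, dividing by \<open>2 F \<ge> 2 m\<close> bounds \<open>gradient F\<close>. This makes \<open>F\<close>
  Lipschitz, and then the difference of the identity at two points bounds the variation of
  \<open>gradient F\<close> by those of \<open>gradient f\<close> and \<open>F\<close>.\<close>
lemma shifted_sqrt_gradient_lipschitz_on: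
  fixes f :: "'a::euclidean_space \<Rightarrow> real"
  assumes "C2 f" "compact K" "convex K"
    and m: "0 < m" "\<And>x. m \<le> shifted_sqrt f c x"
  obtains L M where "lipschitz_on L K (gradient (shifted_sqrt f c))"
    and "0 < L" "0 < M" "\<And>x. x \<in> K \<Longrightarrow> norm (gradient (shifted_sqrt f c) x) \<le> M"
proof -
  define F where "F = shifted_sqrt f c"
  define g where "g = gradient F"
  have mF: "m \<le> F x" for x using m(2) by (simp add: F_def)
  then have Fpos: "0 < F x" for x using m(1) by (meson less_le_trans)
  have Ff: "gradient f x = (2 * F x) *\<^sub>R g x" and FD: "GDERIV F x :> g x" for x
    using shifted_sqrt_gradient[OF C2_imp_GDERIV_gradient[OF \<open>C2 f\<close>, of x], of c] Fpos[of x]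
    by (auto simp: F_def g_def)
  obtain l where l: "lipschitz_on l K (gradient f)"
    using C2_imp_gradient_lipschitz_on assms(1-3) by blast
  have "compact (gradient f ` K)"
    by (rule compact_continuous_image[OF lipschitz_on_continuous_on[OF l] assms(2)])
  then obtain N where "0 < N" and N: "\<And>x. x \<in> K \<Longrightarrow> norm (gradient f x) \<le> N"
    using bounded_pos[of "gradient f ` K"] by (auto simp: compact_imp_bounded)
  define M where "M = N / (2 * m)"
  have M: "norm (g x) \<le> M" if "x \<in> K" for x
  proof -
    have "2 * m * norm (g x) \<le> 2 * F x * norm (g x)"
      using mF by (intro mult_right_mono) auto
    also have "\<dots> = norm (gradient f x)" using Fpos[of x] by (simp add: Ff)
    also have "\<dots> \<le> N" using N that .
    finally show ?thesis using m(1) by (simp add: M_def field_simps)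
  qed
  have "0 < M" using \<open>0 < N\<close> m(1) by (simp add: M_def)
  have F_lip: "\<bar>F x - F y\<bar> \<le> M * norm (x - y)" if "x \<in> K" "y \<in> K" for x y
  proof -
    have "norm (F x - F y) \<le> M * norm (x - y)"
    proof (rule differentiable_bound[OF \<open>convex K\<close>])
      fix z assume "z \<in> K"
      show "(F has_derivative (\<lambda>h. h \<bullet> g z)) (at z within K)"
        using FD unfolding gderiv_def by (rule has_derivative_at_withinI)
      show "onorm (\<lambda>h. h \<bullet> g z) \<le> M"
      proof (rule onorm_bound)
        fix h
        have "norm (h \<bullet> g z) \<le> norm h * norm (g z)" by (simp add: Cauchy_Schwarz_ineq2)
        also have "\<dots> \<le> norm h * M" using M[OF \<open>z \<in> K\<close>] by (intro mult_left_mono) auto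
        finally show "norm (h \<bullet> g z) \<le> M * norm h" by (simp add: mult.commute)
      qed (use \<open>0 < M\<close> in simp)
    qed (use that in auto)
    then show ?thesis by simp
  qed
  define L where "L = (l + 2 * M * M) / (2 * m)"
  have "0 < L" using lipschitz_on_nonneg[OF l] \<open>0 < M\<close> m(1) by (simp add: L_def add_nonneg_pos)
  have "norm (g x - g y) \<le> L * norm (x - y)" if "x \<in> K" "y \<in> K" for x y
  proof -
    have eq: "(2 * F x) *\<^sub>R (g x - g y) = (gradient f x - gradient f y) - (2 * (F x - F y)) *\<^sub>R g y"
      by (simp add: Ff algebra_simps)
    have "2 * m * norm (g x - g y) \<le> 2 * F x * norm (g x - g y)"
      using mF by (intro mult_right_mono) auto
    also have "\<dots> = norm ((2 * F x) *\<^sub>R (g x - g y))" using Fpos[of x] by simp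
    also have "\<dots> \<le> norm (gradient f x - gradient f y) + norm ((2 * (F x - F y)) *\<^sub>R g y)"
      unfolding eq by (rule norm_triangle_ineq4)
    also have "\<dots> = norm (gradient f x - gradient f y) + 2 * (\<bar>F x - F y\<bar> * norm (g y))"
      by (simp add: abs_mult del: right_diff_distrib_numeral)
    also have "\<dots> \<le> l * norm (x - y) + 2 * (M * norm (x - y) * M)"
    proof (intro add_mono mult_left_mono mult_mono)
      show "norm (gradient f x - gradient f y) \<le> l * norm (x - y)"
        using lipschitz_onD[OF l that] by (simp add: dist_norm)
    qed (use F_lip M that \<open>0 < M\<close> in auto)
    finally show ?thesis using m(1) by (simp add: L_def field_simps)
  qed
  then have "lipschitz_on L K g"
    using \<open>0 < L\<close> by (intro lipschitz_onI) (auto simp: dist_norm)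
  then show ?thesis using that \<open>0 < L\<close> \<open>0 < M\<close> M unfolding g_def F_def by blast
qed

lemma coercive_shifted_sqrt_sublevel_bounded:
  fixes f :: "'a::real_normed_vector \<Rightarrow> real"
  assumes "coercive f"
  obtains R where "\<And>x. shifted_sqrt f c x \<le> a \<Longrightarrow> norm x \<le> R"
proof -
  have "eventually (\<lambda>x. a\<^sup>2 + \<bar>c\<bar> < f x) at_infinity"
    using assms unfolding coercive_def filterlim_at_top_dense by blast
  then obtain R where R: "\<And>x. R \<le> norm x \<Longrightarrow> a\<^sup>2 + \<bar>c\<bar> < f x"
    unfolding eventually_at_infinity by blast
  have "norm x \<le> R" if "shifted_sqrt f c x \<le> a" for x
  proof (rule ccontr)
    assume "\<not> norm x \<le> R"
    then have "a\<^sup>2 < f x + c" using R[of x] by auto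
    then have "sqrt (a\<^sup>2) < sqrt (f x + c)" by (rule real_sqrt_less_mono)
    with that show False by (simp add: shifted_sqrt_def)
  qed
  then show ?thesis using that by blast
qed

section \<open>Energy estimates for the iteration\<close>

text \<open>A run of the scheme on a function bounded below by \<open>m\<close>. The smoothness constants \<open>L\<close> and \<open>M\<close> are
  only available on \<open>B\<close>, which has to contain the unit neighbourhood of the sublevel set of the
  starting point. The condition \<open>eta_M\<close> makes steps at most unit length, so that they stay in \<open>B\<close>;
  \<open>eta_L\<close> makes the second-order error so small that \<open>r\<close> stays above \<open>m / 2\<close>.\<close>
locale agem_iteration =
  fixes F :: "'a::real_inner \<Rightarrow> real" and \<beta> \<eta> :: real and \<theta>0 :: 'a
    and \<theta> :: "nat \<Rightarrow> 'a" and r :: "nat \<Rightarrow> real" and v :: "nat \<Rightarrow> 'a"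
    and m L M :: real and B :: "'a set"
  assumes agem: "AGEM F \<beta> \<eta> \<theta>0 \<theta> r v"
    and beta: "0 \<le> \<beta>" "\<beta> < 1" and eta_pos: "0 < \<eta>"
    and m_pos: "0 < m" and F_ge: "\<And>x. m \<le> F x"
    and grad: "\<And>x. GDERIV F x :> gradient F x"
    and lip: "lipschitz_on L B (gradient F)"
    and grad_bound: "\<And>x. x \<in> B \<Longrightarrow> norm (gradient F x) \<le> M"
    and region: "\<And>x y. F x \<le> F \<theta>0 \<Longrightarrow> dist x y \<le> 1 \<Longrightarrow> y \<in> B"
    and eta_M: "2 * \<eta> * F \<theta>0 * M \<le> 1"
    and eta_L: "4 * \<eta> * L * (F \<theta>0)\<^sup>2 \<le> m"
begin

definition v_prev :: "nat \<Rightarrow> 'a" where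
  "v_prev k = (if k = 0 then 0 else v (k - 1))"

definition energy :: "nat \<Rightarrow> real" where
  "energy k = F (\<theta> k) + \<eta> * \<beta> / (1 - \<beta>) * r k * (norm (v_prev k))\<^sup>2"

text \<open>A bound for the second-order error of a step, as a fraction of the drop of \<open>r\<close>.\<close>
definition slack :: real where
  "slack = 2 * \<eta> * L * F \<theta>0"

lemma v_prev_simps [simp]: "v_prev 0 = 0" "v_prev (Suc k) = v k"
  by (simp_all add: v_prev_def)

lemma theta_0: "\<theta> 0 = \<theta>0" and r_0: "r 0 = F \<theta>0"
  and v_rec: "v k = \<beta> *\<^sub>R v_prev k + (1 - \<beta>) *\<^sub>R gradient F (\<theta> k)"
  and r_rec: "r (Suc k) = r k / (1 + 2 * \<eta> * (norm (v k))\<^sup>2)"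
  and theta_rec: "\<theta> (Suc k) = \<theta> k - (2 * \<eta> * r (Suc k)) *\<^sub>R v k"
  using agem unfolding AGEM_def v_prev_def by blast+

lemma F_pos: "0 < F x"
  using m_pos F_ge by (meson less_le_trans)

lemma L_nonneg: "0 \<le> L"
  using lip by (rule lipschitz_on_nonneg)

lemma slack_bounds: "0 \<le> slack" "slack \<le> 1 / 2" "slack * F \<theta>0 \<le> m / 2"
proof -
  show "0 \<le> slack" unfolding slack_def using eta_pos L_nonneg F_pos[of \<theta>0] by simp
  show *: "slack * F \<theta>0 \<le> m / 2" using eta_L by (simp add: slack_def power2_eq_square)
  have "slack * F \<theta>0 \<le> 1 / 2 * F \<theta>0" using * F_ge[of \<theta>0] by linarith
  then show "slack \<le> 1 / 2" using F_pos[of \<theta>0] by simp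
qed

lemma denominator_ge_1: "1 \<le> 1 + 2 * \<eta> * (norm (v k))\<^sup>2"
  using eta_pos by simp

lemma r_pos: "0 < r k"
proof (induction k)
  case (Suc k)
  then show ?case using denominator_ge_1[of k] by (simp add: r_rec)
qed (simp add: r_0 F_pos)

text \<open>This identity ties the scheme together: the drop of \<open>r\<close> is the first-order decrease of \<open>F\<close> in a
  gradient step of length \<open>2 * \<eta> * r (Suc k)\<close>.\<close>
lemma r_drop: "r k - r (Suc k) = 2 * \<eta> * r (Suc k) * (norm (v k))\<^sup>2"
proof -
  have "r (Suc k) * (1 + 2 * \<eta> * (norm (v k))\<^sup>2) = r k"
    unfolding r_rec using denominator_ge_1[of k] by simp
  then show ?thesis by (simp add: algebra_simps)
qed

lemma r_Suc_le: "r (Suc k) \<le> r k"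
proof -
  have "0 \<le> 2 * \<eta> * r (Suc k) * (norm (v k))\<^sup>2" using eta_pos r_pos[of "Suc k"] by simp
  then show ?thesis using r_drop[of k] by linarith
qed

lemma decseq_r: "decseq r"
  by (rule decseq_SucI) (rule r_Suc_le)

lemma r_le: "r k \<le> F \<theta>0"
  using decseqD[OF decseq_r, of 0 k] by (simp add: r_0)

text \<open>Each \<open>v k\<close> is a convex combination of the previous one and the current gradient, starting from
  zero.\<close>
lemma norm_v_le:
  assumes "\<And>j. j \<le> k \<Longrightarrow> norm (gradient F (\<theta> j)) \<le> C"
  shows "norm (v k) \<le> C"
  using assms
proof (induction k)
  have conv: "norm (v k) \<le> C" if "norm (v_prev k) \<le> C" "norm (gradient F (\<theta> k)) \<le> C" for k
  proof -
    have "norm (v k) \<le> norm (\<beta> *\<^sub>R v_prev k) + norm ((1 - \<beta>) *\<^sub>R gradient F (\<theta> k))"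
      unfolding v_rec[of k] by (rule norm_triangle_ineq)
    also have "\<dots> = \<beta> * norm (v_prev k) + (1 - \<beta>) * norm (gradient F (\<theta> k))"
      using beta by simp
    also have "\<dots> \<le> \<beta> * C + (1 - \<beta>) * C"
      using that beta by (intro add_mono mult_left_mono) auto
    finally show ?thesis by (simp add: algebra_simps)
  qed
  {
    case 0
    then have "norm (gradient F (\<theta> 0)) \<le> C" by simp
    moreover from this have "norm (v_prev 0) \<le> C"
      using norm_ge_zero[of "gradient F (\<theta> 0)"] unfolding v_prev_simps norm_zero by linarith
    ultimately show ?case by (intro conv)
  next
    case (Suc k)
    then show ?case by (intro conv) auto
  }
qed

lemma step_length: "norm (\<theta> (Suc k) - \<theta> k) = 2 * \<eta> * r (Suc k) * norm (v k)"
  using eta_pos r_pos[of "Suc k"] by (simp add: theta_rec)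

text \<open>The key estimate. The cross term \<open>v k \<bullet> v_prev k\<close> is split by \<open>2 a b \<le> a^2 + b^2\<close>. The half with
  \<open>v k\<close> becomes the momentum term of the new energy, the half with \<open>v_prev k\<close> is paid for by that of
  the old energy because \<open>r\<close> decreases, and the remaining coefficient of \<open>|v k|^2\<close> is exactly one.\<close>
lemma energy_step:
  assumes inF: "F (\<theta> k) \<le> F \<theta>0" and vM: "norm (v k) \<le> M"
  shows "energy (Suc k) \<le> energy k - (1 - slack) * (r k - r (Suc k))"
    and "closed_segment (\<theta> k) (\<theta> (Suc k)) \<subseteq> B"
proof -
  define s where "s = 2 * \<eta> * r (Suc k)"
  define b where "b = \<beta> / (1 - \<beta>)"
  have bs: "\<eta> * b * r (Suc k) = b * s / 2" by (simp add: s_def)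
  have b0: "0 \<le> b" using beta by (simp add: b_def)
  have energy_eq: "energy j = F (\<theta> j) + \<eta> * b * r j * (norm (v_prev j))\<^sup>2" for j
    by (simp add: energy_def b_def)
  have s0: "0 \<le> s" using eta_pos r_pos[of "Suc k"] by (simp add: s_def)
  have sF: "s \<le> 2 * \<eta> * F \<theta>0"
    unfolding s_def using eta_pos r_le by (intro mult_left_mono) auto
  have "norm (\<theta> (Suc k) - \<theta> k) \<le> 2 * \<eta> * F \<theta>0 * M"
    unfolding step_length s_def[symmetric] using s0 sF vM eta_pos F_pos[of \<theta>0]
    by (intro mult_mono) auto
  with eta_M have short: "norm (\<theta> (Suc k) - \<theta> k) \<le> 1" by linarith
  show seg: "closed_segment (\<theta> k) (\<theta> (Suc k)) \<subseteq> B"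
  proof
    fix z assume "z \<in> closed_segment (\<theta> k) (\<theta> (Suc k))"
    from segment_bound(1)[OF this] short have "dist (\<theta> k) z \<le> 1"
      by (simp add: dist_norm norm_minus_commute)
    with inF show "z \<in> B" by (rule region)
  qed
  let ?G = "gradient F (\<theta> k)" and ?a = "(norm (v k))\<^sup>2" and ?p = "(norm (v_prev k))\<^sup>2"
  have step: "\<theta> (Suc k) - \<theta> k = - (s *\<^sub>R v k)" by (simp add: theta_rec s_def)
  have "F (\<theta> (Suc k)) \<le> F (\<theta> k) - s * (v k \<bullet> ?G) + L * (s\<^sup>2 * ?a)"
    using descent_estimate[OF grad lip seg] unfolding step by (simp add: power_mult_distrib)
  \<comment> \<open>Eliminate the gradient through the recursion for \<open>v\<close>.\<close>
  moreover have "2 * (1 - \<beta>) * (v k \<bullet> ?G) \<ge> 2 * ?a - \<beta> * ?a - \<beta> * ?p"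
  proof -
    have "v k \<bullet> v k = \<beta> * (v k \<bullet> v_prev k) + (1 - \<beta>) * (v k \<bullet> ?G)"
      by (subst (2) v_rec) (simp add: inner_add_right)
    moreover have "0 \<le> (v k - v_prev k) \<bullet> (v k - v_prev k)" by simp
    then have "2 * (v k \<bullet> v_prev k) \<le> ?a + ?p"
      by (simp add: power2_norm_eq_inner inner_diff_left inner_diff_right inner_commute)
    then have "\<beta> * (2 * (v k \<bullet> v_prev k)) \<le> \<beta> * (?a + ?p)"
      using beta by (intro mult_left_mono) auto
    ultimately show ?thesis by (simp add: power2_norm_eq_inner algebra_simps)
  qed
  then have "v k \<bullet> ?G \<ge> ?a + b / 2 * (?a - ?p)"
    using beta by (simp add: b_def field_simps)
  then have "s * (v k \<bullet> ?G) \<ge> s * (?a + b / 2 * (?a - ?p))"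
    using s0 by (rule mult_left_mono)
  moreover have "L * (s\<^sup>2 * ?a) \<le> slack * (s * ?a)"
  proof -
    have "L * s * (s * ?a) \<le> L * (2 * \<eta> * F \<theta>0) * (s * ?a)"
      using L_nonneg sF s0 by (intro mult_right_mono mult_left_mono) auto
    then show ?thesis by (simp add: slack_def power2_eq_square mult_ac)
  qed
  moreover have "s * (b / 2 * ?p) \<le> \<eta> * b * r k * ?p"
  proof -
    have "\<eta> * b * ?p * r (Suc k) \<le> \<eta> * b * ?p * r k"
      using b0 eta_pos r_Suc_le by (intro mult_left_mono) auto
    then show ?thesis by (simp add: s_def mult_ac)
  qed
  ultimately show "energy (Suc k) \<le> energy k - (1 - slack) * (r k - r (Suc k))"
    unfolding energy_eq r_drop s_def[symmetric] v_prev_simps bs by (simp add: algebra_simps)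
qed

lemma F_le_energy: "F (\<theta> k) \<le> energy k"
  unfolding energy_def using beta eta_pos r_pos[of k] by simp

text \<open>The three bounds need each other: a step can only be estimated while the iterates so far lie in
  the initial sublevel set (which also bounds \<open>v\<close>), and the energy estimate keeps the next iterate
  there. Strong induction is used because \<open>v k\<close> involves all earlier gradients.\<close>
lemma invariants:
  shows F_theta_le: "F (\<theta> k) \<le> F \<theta>0" and norm_v_le_M: "norm (v k) \<le> M"
    and energy_r: "energy k - (1 - slack) * r k \<le> slack * F \<theta>0"
proof -
  have v_ok: "norm (v k) \<le> M" if "\<And>j. j \<le> k \<Longrightarrow> F (\<theta> j) \<le> F \<theta>0" for k
    using that by (intro norm_v_le grad_bound region[of "\<theta> j" "\<theta> j" for j]) auto
  have drop: "energy k - (1 - slack) * r k \<le> slack * F \<theta>0 \<Longrightarrow> F (\<theta> k) \<le> F \<theta>0" for k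
  proof -
    assume "energy k - (1 - slack) * r k \<le> slack * F \<theta>0"
    moreover have "(1 - slack) * r k \<le> (1 - slack) * F \<theta>0"
      using slack_bounds r_le by (intro mult_left_mono) auto
    ultimately show ?thesis using F_le_energy[of k] by (simp add: algebra_simps)
  qed
  have "\<forall>j\<le>k. energy j - (1 - slack) * r j \<le> slack * F \<theta>0" for k
  proof (induction k)
    case 0
    then show ?case by (simp add: energy_def theta_0 r_0 algebra_simps)
  next
    case (Suc k)
    then have *: "F (\<theta> j) \<le> F \<theta>0" if "j \<le> k" for j using drop that by blast
    have "energy (Suc k) - (1 - slack) * r (Suc k) \<le> energy k - (1 - slack) * r k"
      using energy_step(1)[OF *[OF order_refl] v_ok[OF *]] by (simp add: algebra_simps)
    with Suc show ?case by (auto simp: le_Suc_eq)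
  qed
  then have all: "energy k - (1 - slack) * r k \<le> slack * F \<theta>0" for k by blast
  then show "energy k - (1 - slack) * r k \<le> slack * F \<theta>0" .
  show "F (\<theta> k) \<le> F \<theta>0" using drop all .
  show "norm (v k) \<le> M" using v_ok drop all by blast
qed

text \<open>The energy stays above \<open>m\<close>, whereas the preserved inequality leaves at most \<open>m / 2\<close> for its excess over
  \<open>(1 - slack) * r k\<close>.\<close>
lemma r_ge: "m / 2 \<le> r k"
proof -
  have "m / 2 \<le> (1 - slack) * r k"
    using energy_r[of k] slack_bounds(3) F_le_energy[of k] F_ge[of "\<theta> k"] by linarith
  also have "\<dots> \<le> 1 * r k"
    using slack_bounds(1) r_pos[of k] by (intro mult_right_mono) auto
  finally show ?thesis by simp
qed

lemma convergent_r: "convergent r"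
  using decseq_convergent[OF decseq_r, of "m / 2"] r_ge by (metis convergentI)

lemma lim_r_le: "lim r \<le> r k"
  using decseq_ge[OF decseq_r] convergent_r by (simp add: convergent_LIMSEQ_iff)

lemma lim_r_pos: "0 < lim r"
proof -
  have "m / 2 \<le> lim r"
    using convergent_r r_ge by (intro LIMSEQ_le_const[of r]) (auto simp: convergent_LIMSEQ_iff)
  then show ?thesis using m_pos by linarith
qed

lemma v_tendsto_0: "v \<longlonglongrightarrow> 0"
proof -
  have r_lim: "r \<longlonglongrightarrow> lim r" using convergent_r by (simp add: convergent_LIMSEQ_iff)
  have "(\<lambda>k. (r k - r (Suc k)) / (\<eta> * m)) \<longlonglongrightarrow> (lim r - lim r) / (\<eta> * m)"
    using eta_pos m_pos by (intro tendsto_intros r_lim LIMSEQ_Suc) auto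
  then have lim0: "(\<lambda>k. (r k - r (Suc k)) / (\<eta> * m)) \<longlonglongrightarrow> 0" by simp
  have "(norm (v k))\<^sup>2 \<le> (r k - r (Suc k)) / (\<eta> * m)" for k
  proof -
    have "2 * \<eta> * (m / 2) * (norm (v k))\<^sup>2 \<le> 2 * \<eta> * r (Suc k) * (norm (v k))\<^sup>2"
      using eta_pos r_ge by (intro mult_right_mono mult_left_mono) auto
    then show ?thesis using eta_pos m_pos by (simp add: r_drop field_simps)
  qed
  then have "(\<lambda>k. (norm (v k))\<^sup>2) \<longlonglongrightarrow> 0"
    by (intro tendsto_sandwich[OF _ _ tendsto_const lim0]) auto
  then have "(\<lambda>k. sqrt ((norm (v k))\<^sup>2)) \<longlonglongrightarrow> sqrt 0" by (rule tendsto_real_sqrt)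
  then show ?thesis by (simp add: tendsto_norm_zero_iff)
qed

lemma gradient_tendsto_0: "(\<lambda>k. gradient F (\<theta> k)) \<longlonglongrightarrow> 0"
proof -
  have "(\<lambda>k. (1 / (1 - \<beta>)) *\<^sub>R (v (Suc k) - \<beta> *\<^sub>R v k)) \<longlonglongrightarrow> (1 / (1 - \<beta>)) *\<^sub>R (0 - \<beta> *\<^sub>R 0)"
    by (intro tendsto_intros v_tendsto_0 LIMSEQ_Suc)
  moreover have "(1 / (1 - \<beta>)) *\<^sub>R (v (Suc k) - \<beta> *\<^sub>R v k) = gradient F (\<theta> (Suc k))" for k
    using v_rec[of "Suc k"] beta by simp
  ultimately have "(\<lambda>k. gradient F (\<theta> (Suc k))) \<longlonglongrightarrow> 0"
    by (simp only: scaleR_zero_right diff_zero)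
  then show ?thesis by (rule LIMSEQ_imp_Suc)
qed

text \<open>If both successors vanished, \<open>\<theta> (Suc k)\<close> would be a critical point, and \<open>v (Suc k) = \<beta> *\<^sub>R v k\<close>
  would force \<open>\<beta> = 0\<close>. Then \<open>v k\<close> is the gradient at \<open>\<theta> k\<close>, and by the Lipschitz bound a single
  short step changes it by at most half its length, which is too little to reach zero.\<close>
lemma v_nonzero_recurs:
  assumes "v k \<noteq> 0"
  shows "v (Suc k) \<noteq> 0 \<or> v (Suc (Suc k)) \<noteq> 0"
proof (rule ccontr)
  assume "\<not> ?thesis"
  then have z: "v (Suc k) = 0" "v (Suc (Suc k)) = 0" by auto
  have "gradient F (\<theta> (Suc (Suc k))) = 0"
    using v_rec[of "Suc (Suc k)"] z beta by simp
  then have g0: "gradient F (\<theta> (Suc k)) = 0"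
    using theta_rec[of "Suc k"] z by simp
  have "\<beta> *\<^sub>R v k = 0" using v_rec[of "Suc k"] z g0 by simp
  with assms have "\<beta> = 0" by simp
  then have vk: "v k = gradient F (\<theta> k)" using v_rec[of k] by simp
  have "dist (gradient F (\<theta> k)) (gradient F (\<theta> (Suc k))) \<le> L * dist (\<theta> k) (\<theta> (Suc k))"
    using energy_step(2)[OF F_theta_le norm_v_le_M, of k] by (intro lipschitz_onD[OF lip]) auto
  then have "norm (v k) \<le> L * (2 * \<eta> * r (Suc k) * norm (v k))"
    using step_length[of k] by (simp add: g0 vk dist_norm norm_minus_commute)
  also have "\<dots> \<le> L * (2 * \<eta> * F \<theta>0 * norm (v k))"
    using L_nonneg eta_pos r_le by (intro mult_left_mono mult_right_mono) auto
  also have "\<dots> = slack * norm (v k)" by (simp add: slack_def)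
  also have "\<dots> \<le> 1 / 2 * norm (v k)"
    using slack_bounds by (intro mult_right_mono) auto
  finally show False using assms by simp
qed

text \<open>At a noncritical starting point \<open>v 0\<close> is nonzero, so infinitely many \<open>v j\<close> are nonzero, and \<open>r\<close> drops strictly at each of them.\<close>
lemma lim_r_less:
  assumes "gradient F \<theta>0 \<noteq> 0"
  shows "lim r < r k"
proof -
  have "\<exists>j\<ge>k. v j \<noteq> 0" for k
  proof (induction k)
    case 0
    have "v 0 \<noteq> 0" using assms beta v_rec[of 0] by (simp add: theta_0)
    then show ?case by blast
  next
    case (Suc k)
    then obtain j where "k \<le> j" "v j \<noteq> 0" by blast
    then have "Suc k \<le> Suc j" "Suc k \<le> Suc (Suc j)" by auto
    with v_nonzero_recurs[OF \<open>v j \<noteq> 0\<close>] show ?case by blast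
  qed
  then obtain j where j: "k \<le> j" "v j \<noteq> 0" by blast
  have "0 < 2 * \<eta> * r (Suc j) * (norm (v j))\<^sup>2"
    using eta_pos r_pos[of "Suc j"] j(2) by simp
  then have "r (Suc j) < r j" using r_drop[of j] by linarith
  then show ?thesis using lim_r_le[of "Suc j"] decseqD[OF decseq_r j(1)] by linarith
qed

end

section \<open>Convergence of the scheme\<close>

theorem theorem3p1:
  fixes f :: "real ^ 'n \<Rightarrow> real" and c \<beta> :: real and \<theta>0 :: "real ^ 'n"
  defines "F \<equiv> shifted_sqrt f c"
  assumes "C2 f" and "coercive f" and "bdd_below (range f)"
    and "\<forall>x. F x \<ge> sqrt (min_value f + c)" and "sqrt (min_value f + c) > 0"
    and "0 \<le> \<beta>" and "\<beta> < 1"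
  shows "\<exists>\<eta>star>0. \<forall>\<eta>. 0 < \<eta> \<and> \<eta> < \<eta>star \<longrightarrow>
    (\<forall>\<theta> r v. AGEM F \<beta> \<eta> \<theta>0 \<theta> r v \<longrightarrow>
      (bounded (range \<theta>) \<and> bounded (range v) \<and>
       (\<forall>k. \<theta> k \<in> {x. F x \<le> 2 * F \<theta>0}) \<and>
       (\<forall>k. norm (v k) \<le> (MAX j\<in>{..k}. norm (gradient F (\<theta> j))))) \<and>
      (convergent r \<and> lim r > 0 \<and>
       (\<forall>k. r k \<ge> r (Suc k) \<and> r (Suc k) \<ge> lim r) \<and>
       (gradient f \<theta>0 \<noteq> 0 \<longrightarrow> (\<forall>k. r (Suc k) > lim r))) \<and>
      (r \<longlonglongrightarrow> lim r \<and> v \<longlonglongrightarrow> 0 \<and> (\<lambda>k. gradient f (\<theta> k)) \<longlonglongrightarrow> 0))"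
proof -
  define m where "m = sqrt (min_value f + c)"
  have m: "0 < m" "\<And>x. m \<le> F x" using assms(5,6) by (auto simp: m_def)
  have F_pos: "0 < F x" for x using m by (meson less_le_trans)
  note f_grad = C2_imp_GDERIV_gradient[OF \<open>C2 f\<close>]
  have grad: "GDERIV F x :> gradient F x" and f_eq: "gradient f x = (2 * F x) *\<^sub>R gradient F x" for x
    using shifted_sqrt_gradient[OF f_grad, of c x] F_pos[of x] unfolding F_def by auto
  obtain R where R: "\<And>x. F x \<le> F \<theta>0 \<Longrightarrow> norm x \<le> R"
    using coercive_shifted_sqrt_sublevel_bounded[OF \<open>coercive f\<close>] unfolding F_def by blast
  \<comment> \<open>The radius exceeds that of the sublevel set by one, the maximal length of a step.\<close>
  define B :: "(real ^ 'n) set" where "B = cball 0 (R + 1)"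
  have region: "y \<in> B" if "F x \<le> F \<theta>0" "dist x y \<le> 1" for x y
    using R[OF that(1)] that(2) norm_triangle_sub[of y x]
    by (simp add: B_def dist_norm norm_minus_commute)
  obtain L M where lip: "lipschitz_on L B (gradient F)" and LM: "0 < L" "0 < M"
    and bound: "\<And>x. x \<in> B \<Longrightarrow> norm (gradient F x) \<le> M"
    using shifted_sqrt_gradient_lipschitz_on[OF \<open>C2 f\<close>, of B m c] m
    unfolding B_def F_def by (metis compact_cball convex_cball)
  define \<eta>star where "\<eta>star = min (1 / (2 * F \<theta>0 * M)) (m / (4 * L * (F \<theta>0)\<^sup>2))"
  have "0 < \<eta>star" using m LM F_pos[of \<theta>0] by (simp add: \<eta>star_def)
  moreover have "(bounded (range \<theta>) \<and> bounded (range v) \<and>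
       (\<forall>k. \<theta> k \<in> {x. F x \<le> 2 * F \<theta>0}) \<and>
       (\<forall>k. norm (v k) \<le> (MAX j\<in>{..k}. norm (gradient F (\<theta> j))))) \<and>
      (convergent r \<and> lim r > 0 \<and>
       (\<forall>k. r k \<ge> r (Suc k) \<and> r (Suc k) \<ge> lim r) \<and>
       (gradient f \<theta>0 \<noteq> 0 \<longrightarrow> (\<forall>k. r (Suc k) > lim r))) \<and>
      (r \<longlonglongrightarrow> lim r \<and> v \<longlonglongrightarrow> 0 \<and> (\<lambda>k. gradient f (\<theta> k)) \<longlonglongrightarrow> 0)"
    if eta: "0 < \<eta>" "\<eta> < \<eta>star" and agem: "AGEM F \<beta> \<eta> \<theta>0 \<theta> r v" for \<eta> \<theta> r v
  proof -
    interpret agem_iteration F \<beta> \<eta> \<theta>0 \<theta> r v m L M B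
    proof
      have "\<eta> \<le> 1 / (2 * F \<theta>0 * M)" "\<eta> \<le> m / (4 * L * (F \<theta>0)\<^sup>2)"
        using eta by (simp_all add: \<eta>star_def)
      then show "2 * \<eta> * F \<theta>0 * M \<le> 1" "4 * \<eta> * L * (F \<theta>0)\<^sup>2 \<le> m"
        using LM F_pos[of \<theta>0] by (simp_all add: pos_le_divide_eq mult_ac)
    qed (use agem assms eta m grad lip bound region in auto)
    have "bounded (range \<theta>)" using R F_theta_le by (auto simp: bounded_iff)
    moreover have "bounded (range v)" using norm_v_le_M by (auto simp: bounded_iff)
    moreover have "F (\<theta> k) \<le> 2 * F \<theta>0" for k
      using F_theta_le[of k] F_pos[of \<theta>0] by linarith
    moreover have "norm (v k) \<le> (MAX j\<in>{..k}. norm (gradient F (\<theta> j)))" for k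
      by (intro norm_v_le Max_ge) auto
    moreover have "lim r < r k" if "gradient f \<theta>0 \<noteq> 0" for k
      using that by (intro lim_r_less) (auto simp: f_eq)
    moreover have "r \<longlonglongrightarrow> lim r" using convergent_r by (simp add: convergent_LIMSEQ_iff)
    \<comment> \<open>The factor \<open>2 * F (\<theta> k)\<close> relating the two gradients is bounded along the run.\<close>
    moreover have "(\<lambda>k. gradient f (\<theta> k)) \<longlonglongrightarrow> 0"
    proof -
      have "(\<lambda>k. (2 * F \<theta>0) *\<^sub>R gradient F (\<theta> k)) \<longlonglongrightarrow> (2 * F \<theta>0) *\<^sub>R 0"
        by (intro tendsto_intros gradient_tendsto_0)
      then have lim0: "(\<lambda>k. norm ((2 * F \<theta>0) *\<^sub>R gradient F (\<theta> k))) \<longlonglongrightarrow> 0"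
        unfolding scaleR_zero_right by (rule tendsto_norm_zero)
      have "norm (gradient f (\<theta> k)) \<le> norm ((2 * F \<theta>0) *\<^sub>R gradient F (\<theta> k))" for k
        using F_theta_le[of k] F_pos[of "\<theta> k"] F_pos[of \<theta>0] by (simp add: f_eq mult_right_mono)
      then have "(\<lambda>k. norm (gradient f (\<theta> k))) \<longlonglongrightarrow> 0"
        by (intro tendsto_sandwich[OF _ _ tendsto_const lim0]) auto
      then show ?thesis by (simp add: tendsto_norm_zero_iff)
    qed
    ultimately show ?thesis
      using convergent_r lim_r_pos lim_r_le r_Suc_le v_tendsto_0 by blast
  qed
  ultimately show ?thesis by blast
qed

end
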